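(* Let $k\ge 2$ and $n\ge 2$ be integers. Among all $k$-cell multinomial pmfs $f_{\mathbf p}$ with $n$ trials, the equal-cell-probability pmf $f_{\mathrm{ecp}}$ is the closest to $f_{\mathrm{unif}}$ in the Kullback-Leibler sense; that is, for every $\mathbf p\in\mathcal P_k\setminus\{\mathbf p_{\mathrm{ecp}}\}$, $$\mathrm E_{\mathrm{unif}}\left[\log\frac{f_{\mathrm{unif}}(\mathbf X)}{f_{\mathbf p}(\mathbf X)}\right]>\mathrm E_{\mathrm{unif}}\left[\log\frac{f_{\mathrm{unif}}(\mathbf X)}{f_{\mathrm{ecp}}(\mathbf X)}\right].$$ Here the left and right sides are the Kullback-Leibler divergences from $f_{\mathbf p}$ to $f_{\mathrm{unif}}$ and from $f_{\mathrm{ecp}}$ to $f_{\mathrm{unif}}$ respectively, and both are positive.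
   Context: Let $\mathcal S_{k,n}=\{\mathbf x=(x_1,\dots,x_k): x_j\in\mathbb Z_{\ge 0},\ \sum_{j=1}^k x_j=n\}$ and $\mathcal P_k=\{\mathbf p=(p_1,\dots,p_k): 0\le p_j\le 1,\ \sum_{j=1}^k p_j=1\}$. For $\mathbf p\in\mathcal P_k$ the multinomial pmf is $f_{\mathbf p}(\mathbf x)=\frac{n!}{\prod_{j=1}^k x_j!}\prod_{j=1}^k p_j^{x_j}$ for $\mathbf x\in\mathcal S_{k,n}$ (with $0^0=1$). Let $\mathbf p_{\mathrm{ecp}}=(1/k,\dots,1/k)$ and $f_{\mathrm{ecp}}=f_{\mathbf p_{\mathrm{ecp}}}$. The uniform pmf on $\mathcal S_{k,n}$ is $f_{\mathrm{unif}}(\mathbf x)=1/\binom{n+k-1}{k-1}$, and $\mathrm E_{\mathrm{unif}}$ denotes expectation when $\mathbf X$ has pmf $f_{\mathrm{unif}}$. Convention: $\log(a/0)=+\infty$ for $a>0$, so an expectation may equal $+\infty$. *)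

theory Defs
  imports "HOL-Probability.Probability"
begin

text \<open>
  Vectors with \<open>k\<close> entries are functions on \<open>{1..k}\<close>, extended by \<open>undefined\<close> outside
  (\<open>\<rightarrow>\<^sub>E\<close>), so that equality of vectors is equality of functions.
\<close>

definition count_vectors :: "nat \<Rightarrow> nat \<Rightarrow> (nat \<Rightarrow> nat) set" where
  "count_vectors k n = {x \<in> {1..k} \<rightarrow>\<^sub>E UNIV. (\<Sum>j=1..k. x j) = n}"

definition cell_probs :: "nat \<Rightarrow> (nat \<Rightarrow> real) set" where
  "cell_probs k = {p \<in> {1..k} \<rightarrow>\<^sub>E {0..1}. (\<Sum>j=1..k. p j) = 1}"

definition p_ecp :: "nat \<Rightarrow> nat \<Rightarrow> real" where
  "p_ecp k = (\<lambda>j\<in>{1..k}. 1 / real k)"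

definition f_mult :: "nat \<Rightarrow> nat \<Rightarrow> (nat \<Rightarrow> real) \<Rightarrow> (nat \<Rightarrow> nat) \<Rightarrow> real" where
  "f_mult k n p x = fact n / (\<Prod>j=1..k. fact (x j)) * (\<Prod>j=1..k. p j ^ x j)"

definition f_ecp :: "nat \<Rightarrow> nat \<Rightarrow> (nat \<Rightarrow> nat) \<Rightarrow> real" where
  "f_ecp k n = f_mult k n (p_ecp k)"

definition f_unif :: "nat \<Rightarrow> nat \<Rightarrow> (nat \<Rightarrow> nat) \<Rightarrow> real" where
  "f_unif k n x = 1 / real ((n + k - 1) choose (k - 1))"

text \<open>
  The expectation is a finite sum in the extended reals. It is only used for integrands that
  never take the value \<open>-\<infinity>\<close>, so no sum of opposite infinities arises.
\<close>

definition E_unif :: "nat \<Rightarrow> nat \<Rightarrow> ((nat \<Rightarrow> nat) \<Rightarrow> ereal) \<Rightarrow> ereal" where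
  "E_unif k n h = (\<Sum>x\<in>count_vectors k n. ereal (f_unif k n x) * h x)"

text \<open>\<open>log (a / b)\<close> with the convention \<open>log (a / 0) = \<infinity>\<close> for \<open>a > 0\<close>.\<close>

definition log_ratio :: "real \<Rightarrow> real \<Rightarrow> ereal" where
  "log_ratio a b = (if b = 0 then \<infinity> else ereal (ln (a / b)))"

text \<open>
  The Kullback-Leibler divergence from the pmf \<open>f\<close> to the pmf \<open>g\<close> on a finite set \<open>A\<close>, with
  natural logarithms. The real-valued \<^const>\<open>KL_divergence\<close> is meaningful only when the second
  measure is absolutely continuous with respect to the first; otherwise the divergence is \<open>\<infinity>\<close>.
\<close>

definition KL_pmf :: "'a set \<Rightarrow> ('a \<Rightarrow> real) \<Rightarrow> ('a \<Rightarrow> real) \<Rightarrow> ereal" where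
  "KL_pmf A f g =
    (if absolutely_continuous (point_measure A f) (point_measure A g)
     then ereal (KL_divergence (exp 1) (point_measure A f) (point_measure A g))
     else \<infinity>)"

lemma KL_pmf_eq_sum:
  assumes fin: "finite A" and f: "\<And>x. x \<in> A \<Longrightarrow> 0 \<le> f x" and g: "\<And>x. x \<in> A \<Longrightarrow> 0 < g x"
  shows "KL_pmf A f g = (\<Sum>x\<in>A. ereal (g x) * log_ratio (g x) (f x))"
proof (cases "\<exists>x\<in>A. f x = 0")
  case True
  then obtain a where a: "a \<in> A" "f a = 0" by blast
  have "{a} \<in> null_sets (point_measure A f)" "{a} \<notin> null_sets (point_measure A g)"
    using a g[of a] by (auto simp: null_sets_point_measure_iff)
  then have "KL_pmf A f g = \<infinity>"
    by (auto simp: KL_pmf_def absolutely_continuous_def)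
  moreover have "ereal (g a) * log_ratio (g a) (f a) = \<infinity>"
    using a g[of a] by (simp add: log_ratio_def)
  then have "(\<Sum>x\<in>A. ereal (g x) * log_ratio (g x) (f x)) = \<infinity>"
    using fin a(1) by (subst sum_Pinfty) blast
  ultimately show ?thesis by simp
next
  case False
  with f have pos: "0 < f x" if "x \<in> A" for x
    using that by (metis order_le_less)
  have nz: "f x \<noteq> 0" if "x \<in> A" for x
    using False that by blast
  interpret sigma_finite_measure "count_space A"
    using fin by (intro sigma_finite_measure_count_space_finite)
  have "absolutely_continuous (point_measure A f) (point_measure A g)"
    using pos by (intro absolutely_continuousI_point_measure_finite) (fastforce simp: ennreal_eq_0_iff)
  moreover have "KL_divergence (exp 1) (point_measure A f) (point_measure A g) =
      (\<Sum>x\<in>A. g x * ln (g x / f x))"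
    unfolding point_measure_def using f g pos fin
    by (subst KL_density_density)
       (auto simp: AE_count_space lebesgue_integral_count_space_finite log_def less_imp_le nz)
  ultimately show ?thesis
    using False by (auto simp: KL_pmf_def log_ratio_def intro!: sum.cong simp flip: sum_ereal)
qed

end

theory Submission
  imports Defs "HOL-Computational_Algebra.Formal_Power_Series"
begin

text \<open>
  If some \<open>p j\<close> vanishes, the divergence is infinite. Otherwise the two divergences differ by
  \<open>\<Sum>j. E[X j] * ln ((1 / k) / p j)\<close>, and by symmetry of the uniform distribution \<open>E[X j]\<close> does not
  depend on \<open>j\<close>; so the difference is a positive multiple of the divergence of \<open>p\<close> from the uniform
  cell probabilities, which is positive by Gibbs' inequality. Gibbs' inequality also gives positivity
  of the divergences themselves; it needs that the pmfs have total mass one, which is read off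
  from generating functions.
\<close>

section \<open>Gibbs' inequality\<close>

text \<open>The bound \<open>ln t \<le> t - 1\<close> at \<open>t = f x / u x\<close> makes each
  summand at least \<open>u x - f x\<close>, strictly so where \<open>f x\<close> and
  \<open>u x\<close> differ; by \<open>le\<close> these differences have a nonnegative sum.\<close>

lemma gibbs_inequality_strict:
  fixes u f :: "'a \<Rightarrow> real"
  assumes fin: "finite A" and pos: "\<And>x. x \<in> A \<Longrightarrow> 0 < u x" "\<And>x. x \<in> A \<Longrightarrow> 0 < f x"
    and le: "sum f A \<le> sum u A" and neq: "\<exists>x\<in>A. f x \<noteq> u x"
  shows "0 < (\<Sum>x\<in>A. u x * ln (u x / f x))"
proof -
  have eq: "u x * ln (u x / f x) = - (u x * ln (f x / u x))" if "x \<in> A" for x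
    using pos[OF that] by (simp add: ln_div algebra_simps)
  have diff: "u x - f x = - (u x * (f x / u x - 1))" if "x \<in> A" for x
    using pos[OF that] by (simp add: field_simps)
  have "sum u A - sum f A = (\<Sum>x\<in>A. u x - f x)" by (simp add: sum_subtractf)
  also have "\<dots> < (\<Sum>x\<in>A. u x * ln (u x / f x))"
  proof (rule sum_strict_mono_ex1[OF fin])
    show "\<forall>x\<in>A. u x - f x \<le> u x * ln (u x / f x)"
      using pos by (simp add: eq diff ln_le_minus_one)
    obtain a where a: "a \<in> A" "f a \<noteq> u a" using neq by blast
    have r: "0 < f a / u a" "f a / u a \<noteq> 1" using pos[OF a(1)] a(2) by auto
    have "ln (f a / u a) < f a / u a - 1"
      using r ln_le_minus_one[OF r(1)] ln_eq_minus_one[OF r(1)] by linarith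
    then have "u a - f a < u a * ln (u a / f a)"
      using pos[OF a(1)] unfolding eq[OF a(1)] diff[OF a(1)] by simp
    with a(1) show "\<exists>x\<in>A. u x - f x < u x * ln (u x / f x)" by blast
  qed
  finally show ?thesis using le by linarith
qed

section \<open>Generating functions and total masses\<close>

lemma finite_PiE_sum_eq:
  fixes n :: nat
  assumes "finite A"
  shows "finite {x \<in> A \<rightarrow>\<^sub>E UNIV. (\<Sum>j\<in>A. x j) = n}"
proof (rule finite_subset)
  show "{x \<in> A \<rightarrow>\<^sub>E UNIV. (\<Sum>j\<in>A. x j) = n} \<subseteq> A \<rightarrow>\<^sub>E {..n}"
    using assms by (auto intro: member_le_sum)
qed (use assms in \<open>simp add: finite_PiE\<close>)

text \<open>A term of the expanded product picks a degree from each factor, and the degrees must add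
  up to \<open>n\<close>. In the induction the Cauchy product splits off the degree taken from the
  new factor.\<close>

lemma fps_nth_prod_PiE:
  fixes g :: "'a \<Rightarrow> nat \<Rightarrow> 'b::comm_ring_1"
  assumes "finite A"
  shows "fps_nth (\<Prod>j\<in>A. Abs_fps (g j)) n
    = (\<Sum>x | x \<in> A \<rightarrow>\<^sub>E UNIV \<and> (\<Sum>j\<in>A. x j) = n. \<Prod>j\<in>A. g j (x j))"
  using assms
proof (induction A arbitrary: n rule: finite_induct)
  case empty
  show ?case by simp
next
  case (insert a A)
  define V where "V m = {x \<in> A \<rightarrow>\<^sub>E UNIV. (\<Sum>j\<in>A. x j) = m}" for m :: nat
  have upd: "(\<Sum>j\<in>A. (x(a := i)) j) = (\<Sum>j\<in>A. x j)" for x and i :: nat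
    using insert(2) by (intro sum.cong) auto
  have updp: "(\<Prod>j\<in>A. g j ((x(a := i)) j)) = (\<Prod>j\<in>A. g j (x j))" for x and i :: nat
    using insert(2) by (intro prod.cong) auto
  have "fps_nth (\<Prod>j\<in>insert a A. Abs_fps (g j)) n
      = (\<Sum>i=0..n. g a i * (\<Sum>x\<in>V (n - i). \<Prod>j\<in>A. g j (x j)))"
    using insert by (simp add: fps_mult_nth V_def)
  also have "\<dots> = (\<Sum>(i, x)\<in>(SIGMA i:{0..n}. V (n - i)). g a i * (\<Prod>j\<in>A. g j (x j)))"
    using insert(1) by (simp add: sum_distrib_left sum.Sigma V_def finite_PiE_sum_eq)
  also have "\<dots> = (\<Sum>x | x \<in> insert a A \<rightarrow>\<^sub>E UNIV \<and> (\<Sum>j\<in>insert a A. x j) = n.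
      \<Prod>j\<in>insert a A. g j (x j))"
  \<comment> \<open>The inverse map resets the value at \<open>a\<close> to
    \<open>undefined\<close>, so that the remaining vector is extensional on
    \<open>A\<close>.\<close>
  proof (rule sum.reindex_bij_witness[where j = "\<lambda>(i, x). x(a := i)"
        and i = "\<lambda>x. (x a, x(a := undefined))"], goal_cases)
    case (1 z)
    then show ?case using insert(2) by (auto simp: V_def PiE_iff extensional_def)
  next
    case (2 z)
    then show ?case using insert(1,2) upd
      by (auto simp: V_def PiE_iff extensional_def simp del: fun_upd_apply) (auto split: if_splits)
  next
    case (3 x)
    then show ?case by auto
  next
    case (4 x)
    then show ?case using insert(1,2) upd
      by (auto simp: V_def simp del: fun_upd_apply intro!: fun_upd_in_PiE)
  next
    case (5 z)
    then show ?case using insert(1,2) updp by (auto simp del: fun_upd_apply) (auto)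
  qed
  finally show ?case .
qed

text \<open>Multiplying by the geometric series forms partial sums of coefficients, so the induction
  step is the hockey-stick identity. The exponent \<open>Suc k\<close> avoids truncated
  subtraction.\<close>

lemma fps_ones_power_nth:
  "fps_nth (Abs_fps (\<lambda>_. 1 :: 'a::comm_ring_1) ^ Suc k) n = of_nat ((n + k) choose k)"
proof (induction k arbitrary: n)
  case (Suc k)
  have "fps_nth (Abs_fps (\<lambda>_. 1 :: 'a) ^ Suc (Suc k)) n = (\<Sum>i=0..n. of_nat ((i + k) choose k))"
    by (subst power_Suc2, subst fps_mult_nth) (simp del: power_Suc add: Suc.IH)
  also have "\<dots> = of_nat (\<Sum>i\<le>n. (k + i) choose i)"
    by (simp add: atLeast0AtMost add.commute binomial_symmetric[of k])
  also have "\<dots> = of_nat ((n + Suc k) choose Suc k)"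
    by (subst sum_choose_lower) (simp add: add.commute binomial_symmetric[of "Suc k"] del: binomial_Suc_Suc)
  finally show ?case .
qed simp

lemma finite_count_vectors: "finite (count_vectors k n)"
  unfolding count_vectors_def by (rule finite_PiE_sum_eq) simp

text \<open>Stars and bars: with all coefficients 1, \<open>fps_nth_prod_PiE\<close> counts vectors.
  The count is cast to \<open>int\<close> because that lemma needs a commutative ring.\<close>

lemma card_count_vectors:
  assumes "k \<ge> 1"
  shows "card (count_vectors k n) = (n + k - 1) choose (k - 1)"
proof -
  have "int (card (count_vectors k n)) = fps_nth (\<Prod>j\<in>{1..k}. Abs_fps (\<lambda>_. 1)) n"
    by (subst fps_nth_prod_PiE) (simp_all add: count_vectors_def)
  also have "\<dots> = fps_nth (Abs_fps (\<lambda>_. 1) ^ Suc (k - 1)) n"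
    using assms by simp
  also have "\<dots> = int ((n + k - 1) choose (k - 1))"
    unfolding fps_ones_power_nth using assms by simp
  finally show ?thesis by simp
qed

lemma f_unif_pos:
  assumes "k \<ge> 1"
  shows "0 < f_unif k n x"
  using assms by (simp add: f_unif_def)

lemma sum_f_unif:
  assumes "k \<ge> 1"
  shows "(\<Sum>x\<in>count_vectors k n. f_unif k n x) = 1"
  using assms by (simp add: f_unif_def card_count_vectors)

lemma prod_fps_exp:
  fixes p :: "'a \<Rightarrow> 'b::field_char_0"
  shows "(\<Prod>j\<in>A. fps_exp (p j)) = fps_exp (\<Sum>j\<in>A. p j)"
  by (induction A rule: infinite_finite_induct) (simp_all add: fps_exp_add_mult)

text \<open>The multinomial theorem, read off from the degree \<open>n\<close> coefficient of a
  product of exponential series.\<close>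

lemma sum_f_mult: "(\<Sum>x\<in>count_vectors k n. f_mult k n p x) = (\<Sum>j=1..k. p j) ^ n"
proof -
  have "(\<Sum>x\<in>count_vectors k n. f_mult k n p x)
      = fact n * (\<Sum>x\<in>count_vectors k n. \<Prod>j=1..k. p j ^ x j / fact (x j))"
    by (simp add: f_mult_def prod_dividef sum_distrib_left)
  also have "(\<Sum>x\<in>count_vectors k n. \<Prod>j=1..k. p j ^ x j / fact (x j))
      = fps_nth (\<Prod>j=1..k. fps_exp (p j)) n"
    unfolding fps_exp_def by (subst fps_nth_prod_PiE) (simp_all add: count_vectors_def)
  finally show ?thesis by (simp add: prod_fps_exp)
qed

section \<open>Symmetry of the coordinates\<close>

text \<open>Swapping the indices \<open>i\<close> and \<open>j\<close> is an involution of the set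
  of count vectors that exchanges the two coordinates.\<close>

lemma sum_coordinate_count_vectors:
  assumes "i \<in> {1..k}" "j \<in> {1..k}"
  shows "(\<Sum>x\<in>count_vectors k n. x i) = (\<Sum>x\<in>count_vectors k n. x j)"
proof -
  let ?t = "Transposition.transpose i j"
  have t: "?t permutes {1..k}" using assms by (rule permutes_swap_id)
  have mem: "x \<circ> ?t \<in> count_vectors k n" if "x \<in> count_vectors k n" for x
  proof -
    have "(\<Sum>l=1..k. (x \<circ> ?t) l) = (\<Sum>l=1..k. x l)"
      using sum.permute[OF t, of x] by (simp add: o_def)
    \<comment> \<open>The transposition fixes every index outside \<open>{1..k}\<close>, so the
      composite is still \<open>undefined\<close> there.\<close>
    moreover have "x \<circ> ?t \<in> {1..k} \<rightarrow>\<^sub>E UNIV"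
      using that permutes_not_in[OF t] by (simp add: count_vectors_def PiE_iff extensional_def)
    ultimately show ?thesis using that by (simp add: count_vectors_def)
  qed
  show ?thesis
    by (rule sum.reindex_bij_witness[where i = "\<lambda>x. x \<circ> ?t" and j = "\<lambda>x. x \<circ> ?t"])
      (use mem in \<open>auto simp: fun_eq_iff\<close>)
qed

lemma single_count_vector:
  assumes "j \<in> {1..k}"
  shows "(\<lambda>i\<in>{1..k}. if i = j then n else 0) \<in> count_vectors k n"
  using assms by (simp add: count_vectors_def)

lemma sum_coordinate_count_vectors_pos:
  assumes "j \<in> {1..k}" "n > 0"
  shows "0 < (\<Sum>x\<in>count_vectors k n. x j)"
proof -
  have "n = (\<lambda>i\<in>{1..k}. if i = j then n else 0) j" using assms by simp
  also have "\<dots> \<le> (\<Sum>x\<in>count_vectors k n. x j)"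
    by (rule member_le_sum[OF single_count_vector[OF assms(1)]]) (simp_all add: finite_count_vectors)
  finally show ?thesis using assms by simp
qed

section \<open>Values of the multinomial pmfs\<close>

lemma f_mult_pos:
  assumes "\<And>j. j \<in> {1..k} \<Longrightarrow> 0 < p j"
  shows "0 < f_mult k n p x"
  unfolding f_mult_def using assms by (intro mult_pos_pos divide_pos_pos prod_pos) auto

lemma f_mult_nonneg:
  assumes "\<And>j. j \<in> {1..k} \<Longrightarrow> 0 \<le> p j"
  shows "0 \<le> f_mult k n p x"
  unfolding f_mult_def using assms by (intro mult_nonneg_nonneg divide_nonneg_nonneg prod_nonneg) auto

lemma f_ecp_eq:
  assumes "x \<in> count_vectors k n"
  shows "f_ecp k n x = fact n / (\<Prod>j=1..k. fact (x j)) * (1 / real k) ^ n"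
proof -
  have "(\<Prod>j=1..k. p_ecp k j ^ x j) = (1 / real k) ^ (\<Sum>j=1..k. x j)"
    unfolding power_sum by (rule prod.cong) (auto simp: p_ecp_def)
  then show ?thesis using assms by (simp add: f_ecp_def f_mult_def count_vectors_def)
qed

lemma f_ecp_pos:
  assumes "k \<ge> 1"
  shows "0 < f_ecp k n x"
  unfolding f_ecp_def using assms by (intro f_mult_pos) (simp add: p_ecp_def)

lemma sum_f_ecp:
  assumes "k \<ge> 1"
  shows "(\<Sum>x\<in>count_vectors k n. f_ecp k n x) = 1"
  using assms by (simp add: f_ecp_def sum_f_mult p_ecp_def)

text \<open>All trials in one cell gives multinomial coefficient 1, while moving one trial to a
  second cell gives \<open>n\<close>. The factor \<open>(1 / k) ^ n\<close> is common, so
  \<open>f_ecp\<close> is not constant.\<close>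

lemma f_ecp_neq_f_unif:
  assumes "k \<ge> 2" "n \<ge> 2"
  shows "\<exists>x\<in>count_vectors k n. f_ecp k n x \<noteq> f_unif k n x"
proof (rule ccontr)
  assume "\<not> ?thesis"
  then have eq: "f_ecp k n x = f_unif k n x" if "x \<in> count_vectors k n" for x
    using that by blast
  define x y where "x = (\<lambda>i\<in>{1..k}. if i = 1 then n else 0)"
    and "y = (\<lambda>i\<in>{1..k}. (if i = 1 then n - 1 else 0) + (if i = 2 then 1 else 0))"
  have x: "x \<in> count_vectors k n"
    unfolding x_def using assms by (intro single_count_vector) simp
  have y: "y \<in> count_vectors k n"
    using assms by (simp add: y_def count_vectors_def sum.distrib)
  have "(\<Prod>j=1..k. fact (x j)) = (\<Prod>j=1..k. if j = 1 then fact n else 1 :: real)"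
    by (rule prod.cong) (auto simp: x_def)
  then have px: "(\<Prod>j=1..k. fact (x j)) = (fact n :: real)" using assms by simp
  \<comment> \<open>The single trial in cell 2 contributes \<open>fact 1 = 1\<close>, just like an
    empty cell.\<close>
  have "(\<Prod>j=1..k. fact (y j)) = (\<Prod>j=1..k. if j = 1 then fact (n - 1) else 1 :: real)"
    by (rule prod.cong) (auto simp: y_def)
  then have py: "(\<Prod>j=1..k. fact (y j)) = (fact (n - 1) :: real)" using assms by simp
  have "f_ecp k n x = f_ecp k n y" using eq[OF x] eq[OF y] by (simp add: f_unif_def)
  then have "fact n = (fact (n - 1) :: real)"
    using assms unfolding f_ecp_eq[OF x] f_ecp_eq[OF y] px py by (simp add: field_simps)
  then show False using assms by (simp add: fact_reduce[of n])
qed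

section \<open>Expected log ratios and their comparison\<close>

lemma E_unif_log_ratio_eq_KL_pmf:
  assumes "k \<ge> 1" "\<And>x. x \<in> count_vectors k n \<Longrightarrow> 0 \<le> f x"
  shows "E_unif k n (\<lambda>x. log_ratio (f_unif k n x) (f x)) = KL_pmf (count_vectors k n) f (f_unif k n)"
  unfolding E_unif_def using assms
  by (intro KL_pmf_eq_sum[symmetric]) (auto simp: finite_count_vectors f_unif_pos)

lemma E_unif_log_ratio_eq_infinity:
  assumes "k \<ge> 1" "y \<in> count_vectors k n" "f y = 0"
  shows "E_unif k n (\<lambda>x. log_ratio (f_unif k n x) (f x)) = \<infinity>"
proof -
  have "ereal (f_unif k n y) * log_ratio (f_unif k n y) (f y) = \<infinity>"
    using assms f_unif_pos[of k n y] by (simp add: log_ratio_def)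
  then show ?thesis
    unfolding E_unif_def using assms(2) by (subst sum_Pinfty) (blast intro: finite_count_vectors)
qed

lemma E_unif_log_ratio_eq_ereal:
  assumes "\<And>x. x \<in> count_vectors k n \<Longrightarrow> 0 < f x"
  shows "E_unif k n (\<lambda>x. log_ratio (f_unif k n x) (f x))
    = ereal (\<Sum>x\<in>count_vectors k n. f_unif k n x * ln (f_unif k n x / f x))"
  unfolding E_unif_def sum_ereal[symmetric]
  by (rule sum.cong) (use assms in \<open>auto simp: log_ratio_def dest: less_imp_neq[symmetric]\<close>)

text \<open>This is the case of positive cell probabilities, stated with real sums so that the two
  sides can be subtracted.\<close>

lemma KL_f_ecp_less_KL_f_mult:
  assumes k: "k \<ge> 1" and n: "n > 0" and pos: "\<And>j. j \<in> {1..k} \<Longrightarrow> 0 < p j"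
    and sum1: "(\<Sum>j=1..k. p j) = 1" and neq: "\<exists>j\<in>{1..k}. p j \<noteq> 1 / real k"
  shows "(\<Sum>x\<in>count_vectors k n. f_unif k n x * ln (f_unif k n x / f_ecp k n x))
    < (\<Sum>x\<in>count_vectors k n. f_unif k n x * ln (f_unif k n x / f_mult k n p x))"
proof -
  let ?S = "count_vectors k n"
  define u where "u = 1 / real ((n + k - 1) choose (k - 1))"
  define c where "c = (\<Sum>x\<in>?S. x 1)"
  have u: "f_unif k n x = u" "0 < u" for x
    using f_unif_pos[OF k] by (simp_all add: f_unif_def u_def)
  have c: "(\<Sum>x\<in>?S. x j) = c" if "j \<in> {1..k}" for j
    unfolding c_def by (rule sum_coordinate_count_vectors) (use that k in auto)
  have ratio_pos: "0 < 1 / real k / p j" if "j \<in> {1..k}" for j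
    using pos[OF that] k by simp
  \<comment> \<open>The factor \<open>u\<close> and the multinomial coefficients cancel, leaving an
    expression linear in the counts \<open>x j\<close>.\<close>
  have ratio: "ln (u / f_mult k n p x) - ln (u / f_ecp k n x)
      = (\<Sum>j=1..k. real (x j) * ln (1 / real k / p j))" for x
  proof -
    have "ln (u / f_mult k n p x) - ln (u / f_ecp k n x) = ln (f_ecp k n x / f_mult k n p x)"
      using f_mult_pos[of k p n x, OF pos] f_ecp_pos[OF k, of n x] u(2) by (simp add: ln_div)
    also have "f_ecp k n x / f_mult k n p x = (\<Prod>j=1..k. p_ecp k j ^ x j) / (\<Prod>j=1..k. p j ^ x j)"
      by (simp add: f_ecp_def f_mult_def)
    also have "\<dots> = (\<Prod>j=1..k. (1 / real k / p j) ^ x j)"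
      unfolding prod_dividef[symmetric] power_divide[symmetric] by (rule prod.cong) (auto simp: p_ecp_def)
    also have "ln \<dots> = (\<Sum>j=1..k. ln ((1 / real k / p j) ^ x j))"
      by (intro ln_prod) (use ratio_pos in \<open>force+\<close>)
    also have "\<dots> = (\<Sum>j=1..k. real (x j) * ln (1 / real k / p j))"
      by (simp add: ln_realpow)
    finally show ?thesis .
  qed
  \<comment> \<open>Gibbs' inequality is applied to the cells here, with weights
    \<open>1 / k\<close> against \<open>p\<close>.\<close>
  have "0 < (\<Sum>j=1..k. 1 / real k * ln (1 / real k / p j))"
    by (rule gibbs_inequality_strict) (use k pos sum1 neq in auto)
  then have "0 < (\<Sum>j=1..k. ln (1 / real k / p j))"
    using k unfolding sum_distrib_left[symmetric] by (simp add: zero_less_divide_iff)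
  moreover have "0 < c" using sum_coordinate_count_vectors_pos[of 1 k n] k n by (simp add: c_def)
  ultimately have "0 < u * (real c * (\<Sum>j=1..k. ln (1 / real k / p j)))"
    using u(2) by simp
  \<comment> \<open>By symmetry \<open>c\<close> is the total of every coordinate, so it can be
    expanded separately for each \<open>j\<close> before the sums are swapped.\<close>
  also have "real c * (\<Sum>j=1..k. ln (1 / real k / p j))
      = (\<Sum>j=1..k. \<Sum>x\<in>?S. real (x j) * ln (1 / real k / p j))"
    unfolding sum_distrib_left
    by (rule sum.cong) (simp_all add: sum_distrib_right[symmetric] c flip: of_nat_sum)
  also have "\<dots> = (\<Sum>x\<in>?S. ln (u / f_mult k n p x) - ln (u / f_ecp k n x))"
    unfolding ratio by (rule sum.swap)
  also have "u * \<dots> = (\<Sum>x\<in>?S. u * ln (u / f_mult k n p x)) - (\<Sum>x\<in>?S. u * ln (u / f_ecp k n x))"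
    by (simp add: sum_subtractf sum_distrib_left right_diff_distrib)
  finally show ?thesis by (simp add: u(1))
qed

theorem proposition3p1:
  fixes k n :: nat
  assumes "k \<ge> 2" and "n \<ge> 2"
  shows "(\<forall>p \<in> cell_probs k - {p_ecp k}.
            E_unif k n (\<lambda>x. log_ratio (f_unif k n x) (f_mult k n p x))
              > E_unif k n (\<lambda>x. log_ratio (f_unif k n x) (f_ecp k n x))
          \<and> E_unif k n (\<lambda>x. log_ratio (f_unif k n x) (f_mult k n p x))
              = KL_pmf (count_vectors k n) (f_mult k n p) (f_unif k n)
          \<and> E_unif k n (\<lambda>x. log_ratio (f_unif k n x) (f_mult k n p x)) > 0)
       \<and> E_unif k n (\<lambda>x. log_ratio (f_unif k n x) (f_ecp k n x))
           = KL_pmf (count_vectors k n) (f_ecp k n) (f_unif k n)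
       \<and> E_unif k n (\<lambda>x. log_ratio (f_unif k n x) (f_ecp k n x)) > 0"
proof -
  let ?S = "count_vectors k n"
  have k: "k \<ge> 1" using assms by simp
  have ecp: "E_unif k n (\<lambda>x. log_ratio (f_unif k n x) (f_ecp k n x))
      = ereal (\<Sum>x\<in>?S. f_unif k n x * ln (f_unif k n x / f_ecp k n x))"
    by (rule E_unif_log_ratio_eq_ereal) (rule f_ecp_pos[OF k])
  have "0 < (\<Sum>x\<in>?S. f_unif k n x * ln (f_unif k n x / f_ecp k n x))"
    using f_ecp_neq_f_unif[OF assms]
    by (intro gibbs_inequality_strict)
      (simp_all add: finite_count_vectors f_unif_pos[OF k] f_ecp_pos[OF k] sum_f_unif[OF k] sum_f_ecp[OF k])
  then have ecp_pos: "0 < E_unif k n (\<lambda>x. log_ratio (f_unif k n x) (f_ecp k n x))"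
    by (simp add: ecp)
  have less: "E_unif k n (\<lambda>x. log_ratio (f_unif k n x) (f_ecp k n x))
      < E_unif k n (\<lambda>x. log_ratio (f_unif k n x) (f_mult k n p x))"
    if p: "p \<in> cell_probs k" "p \<noteq> p_ecp k" for p
  proof (cases "\<exists>j\<in>{1..k}. p j = 0")
    case True
    then obtain j where j: "j \<in> {1..k}" "p j = 0" by blast
    \<comment> \<open>All trials fall into the cell of probability zero; since \<open>n > 0\<close>,
      the factor \<open>0 ^ n\<close> vanishes.\<close>
    let ?y = "\<lambda>i\<in>{1..k}. if i = j then n else 0"
    have "(\<Prod>i=1..k. p i ^ ?y i) = 0"
      using j assms by (intro prod_zero) (auto intro!: bexI[of _ j])
    then have "f_mult k n p ?y = 0" by (simp add: f_mult_def)
    then have "E_unif k n (\<lambda>x. log_ratio (f_unif k n x) (f_mult k n p x)) = \<infinity>"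
      by (rule E_unif_log_ratio_eq_infinity[OF k single_count_vector[OF j(1)],
            where f = "f_mult k n p"])
    then show ?thesis by (simp add: ecp)
  next
    case False
    have pos: "0 < p j" if "j \<in> {1..k}" for j
    proof -
      have "0 \<le> p j" using p(1) that by (simp add: cell_probs_def PiE_iff)
      moreover have "p j \<noteq> 0" using False that by blast
      ultimately show ?thesis by simp
    qed
    \<comment> \<open>Both vectors are extensional, so they can only differ at an index in
      \<open>{1..k}\<close>.\<close>
    have "\<exists>j\<in>{1..k}. p j \<noteq> 1 / real k"
    proof (rule ccontr)
      assume "\<not> ?thesis"
      then have "p = p_ecp k"
        using p(1) by (auto simp: cell_probs_def p_ecp_def PiE_iff extensional_def fun_eq_iff)
      with p(2) show False by simp
    qed
    moreover have "E_unif k n (\<lambda>x. log_ratio (f_unif k n x) (f_mult k n p x))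
        = ereal (\<Sum>x\<in>?S. f_unif k n x * ln (f_unif k n x / f_mult k n p x))"
      by (rule E_unif_log_ratio_eq_ereal) (rule f_mult_pos[OF pos])
    ultimately show ?thesis
      using KL_f_ecp_less_KL_f_mult[of k n p] k assms pos p(1)
      by (simp add: ecp cell_probs_def)
  qed
  have KL: "E_unif k n (\<lambda>x. log_ratio (f_unif k n x) (f_mult k n p x))
      = KL_pmf ?S (f_mult k n p) (f_unif k n)" if "p \<in> cell_probs k" for p
    using that by (intro E_unif_log_ratio_eq_KL_pmf[OF k] f_mult_nonneg)
      (auto simp: cell_probs_def PiE_iff)
  have "E_unif k n (\<lambda>x. log_ratio (f_unif k n x) (f_ecp k n x))
      = KL_pmf ?S (f_ecp k n) (f_unif k n)"
    by (intro E_unif_log_ratio_eq_KL_pmf[OF k] less_imp_le f_ecp_pos[OF k])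
  \<comment> \<open>Positivity for \<open>p\<close> follows by transitivity from positivity for
    \<open>p_ecp\<close>.\<close>
  with less KL ecp_pos show ?thesis by (blast intro: less_trans)
qed

end
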